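(* Let $\beta$ be an arbitrary real $m \times r$ matrix with full column rank $r$. Then: (a) There exist a unique $m\times r$ matrix $\Lambda$ with ordered GLT structure and a unique orthogonal $r \times r$ matrix $G$ such that $\beta = \Lambda G^{\top}$. The matrix $\Lambda$ is called the GLT representation of $\beta$. (b) Let $l_1 < \ldots < l_r$ be the pivot columns of the reduced row echelon form of $\beta^{\top}$, and let $\beta_1$ be the $r \times r$ submatrix of $\beta$ consisting of the rows $l_1, \ldots, l_r$. Then the GLT representation $\Lambda = \beta G$ of $\beta$ has pivot rows $l_1, \ldots, l_r$, and it is obtained with the rotation matrix $G = Q$, where $Q R = \beta_1^{\top}$ is the QR decomposition of $\beta_1^{\top}$ ($Q$ orthogonal, $R$ upper triangular with positive diagonal entries).
   Context: For a real $m \times r$ matrix $\Lambda = (\Lambda_{ij})$ with $r$ non-zero columns, the pivot row $l_j$ of column $j$ is the row index of the first non-zero entry in column $j$, i.e. $\Lambda_{ij} = 0$ for all $i < l_j$ and $\Lambda_{l_j, j} \neq 0$. A real $m \times r$ matrix $\Lambda$ of full column rank $r$ has an ordered GLT (generalized lower triangular) structure if its pivot rows satisfy $l_1 < \ldots < l_r$ and its leading entries are positive, $\Lambda_{l_j,j} > 0$ for $j = 1, \ldots, r$. The pivot columns of a matrix in reduced row echelon form are the column indices of the leading ones of its non-zero rows. *)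

theory Defs
  imports Complex_Main
    "Jordan_Normal_Form.Gauss_Jordan_Elimination"
    "Jordan_Normal_Form.DL_Rank"
begin

text \<open>Matrices are those of \<^theory>\<open>Jordan_Normal_Form.Matrix\<close>; rows and columns are indexed from 0.\<close>

definition is_pivot_row :: "real mat \<Rightarrow> nat \<Rightarrow> nat \<Rightarrow> bool" where
  "is_pivot_row A j i \<longleftrightarrow>
     i < dim_row A \<and> A $$ (i, j) \<noteq> 0 \<and> (\<forall>i' < i. A $$ (i', j) = 0)"

definition full_column_rank :: "real mat \<Rightarrow> bool" where
  "full_column_rank A \<longleftrightarrow> vec_space.rank (dim_row A) A = dim_col A"

definition ordered_GLT :: "real mat \<Rightarrow> bool" where
  "ordered_GLT A \<longleftrightarrow> full_column_rank A \<and>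
     (\<exists>l. (\<forall>j < dim_col A. is_pivot_row A j (l j) \<and> A $$ (l j, j) > 0) \<and>
          strict_mono_on {..< dim_col A} l)"

text \<open>The library's \<^const>\<open>orthogonal_mat\<close> only asks for \<open>G\<^sup>T * G\<close> to be diagonal with
  nonzero diagonal entries, so it is not the usual notion.\<close>

definition is_orthogonal :: "nat \<Rightarrow> real mat \<Rightarrow> bool" where
  "is_orthogonal n G \<longleftrightarrow>
     G \<in> carrier_mat n n \<and> G\<^sup>T * G = 1\<^sub>m n \<and> G * G\<^sup>T = 1\<^sub>m n"

definition GLT_decomposition :: "real mat \<Rightarrow> real mat \<Rightarrow> real mat \<Rightarrow> bool" where
  "GLT_decomposition A \<Lambda> G \<longleftrightarrow>
     \<Lambda> \<in> carrier_mat (dim_row A) (dim_col A) \<and> ordered_GLT \<Lambda> \<and>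
     is_orthogonal (dim_col A) G \<and> A = \<Lambda> * G\<^sup>T"

text \<open>The library's \<^const>\<open>row_echelon_form\<close> is the \<^emph>\<open>reduced\<close> form: leading entries
  are 1 and are the only nonzero entries of their columns.\<close>

definition is_rref_of :: "real mat \<Rightarrow> real mat \<Rightarrow> bool" where
  "is_rref_of C A \<longleftrightarrow> row_echelon_form C \<and>
     (\<exists>P \<in> carrier_mat (dim_row A) (dim_row A). invertible_mat P \<and> C = P * A)"

lemma rref_exists: "\<exists>C. is_rref_of C A"
proof -
  let ?C = "gauss_jordan_single A"
  have A: "A \<in> carrier_mat (dim_row A) (dim_col A)" by simp
  obtain P Q where PQ: "?C = P * A" "P \<in> carrier_mat (dim_row A) (dim_row A)"
    "Q \<in> carrier_mat (dim_row A) (dim_row A)"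
    "P * Q = 1\<^sub>m (dim_row A)" "Q * P = 1\<^sub>m (dim_row A)"
    using gauss_jordan_single(4)[OF A refl] by blast
  then have "invertible_mat P"
    unfolding invertible_mat_def inverts_mat_def by auto
  with PQ gauss_jordan_single(3)[OF A refl] show ?thesis
    unfolding is_rref_of_def by blast
qed

definition pivot_columns :: "real mat \<Rightarrow> nat set" where
  "pivot_columns C = {j. j < dim_col C \<and>
     (\<exists>i < dim_row C. C $$ (i, j) = 1 \<and> (\<forall>j' < j. C $$ (i, j') = 0))}"

definition QR_decomposition :: "real mat \<Rightarrow> real mat \<Rightarrow> real mat \<Rightarrow> bool" where
  "QR_decomposition A Q R \<longleftrightarrow>
     is_orthogonal (dim_row A) Q \<and>
     R \<in> carrier_mat (dim_row A) (dim_col A) \<and> upper_triangular R \<and>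
     (\<forall>i < dim_row R. R $$ (i, i) > 0) \<and> Q * R = A"

end

theory Submission
  imports Defs
begin

text \<open>
  Transposing the reduced row echelon form of \<open>\<beta>\<^sup>T\<close> yields \<open>\<beta> = E * \<beta>1\<close>, where \<open>E\<close> is in column
  echelon form with pivot rows \<open>l\<^sub>1 < \<dots> < l\<^sub>r\<close> and its rows \<open>l\<^sub>1, \<dots>, l\<^sub>r\<close> form the identity matrix.
  If \<open>\<beta>1\<^sup>T = Q * R\<close>, then \<open>\<beta> * Q = E * R\<^sup>T\<close> has ordered GLT structure with the pivot rows of \<open>E\<close>.
  Conversely, the pivot rows of a GLT matrix are the positions of the first nonzero entries of
  the nonzero vectors in its column space, and hence determined by \<open>\<beta>\<close>; so any GLT representation
  \<open>\<beta> * G\<close> restricts on the rows \<open>l\<^sub>1, \<dots>, l\<^sub>r\<close> to a lower triangular matrix \<open>\<beta>1 * G\<close>, and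
  \<open>\<beta>1\<^sup>T = G * (\<beta>1 * G)\<^sup>T\<close> is a QR decomposition. Everything thus reduces to existence and
  uniqueness of the QR decomposition.
\<close>

section \<open>Full column rank as triviality of the kernel\<close>

lemma mult_unit_vec_col:
  fixes A :: "real mat"
  assumes "A \<in> carrier_mat m r" "k < r"
  shows "A *\<^sub>v unit_vec r k = col A k"
  using assms by (intro eq_vecI) (auto simp: scalar_prod_right_unit[of _ r])

text \<open>Linear independence concerns the set of columns and so forgets repetitions, hence the
  case split. With a repeated column both sides fail: the rank is at most the number of distinct
  columns, and the difference of two unit vectors lies in the kernel.\<close>

lemma full_column_rank_iff_trivial_kernel:
  assumes A: "A \<in> carrier_mat m r"
  shows "full_column_rank A \<longleftrightarrow> (\<forall>v \<in> carrier_vec r. A *\<^sub>v v = 0\<^sub>v m \<longrightarrow> v = 0\<^sub>v r)"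
proof -
  interpret vec_space "TYPE(real)" m .
  have fcr: "full_column_rank A \<longleftrightarrow> rank A = r"
    using A by (auto simp: full_column_rank_def)
  show ?thesis
  proof (cases "distinct (cols A)")
    case True
    have "rank A = r \<longleftrightarrow> lin_indpt (set (cols A))"
      using full_rank_lin_indpt[OF A _ True] lin_indpt_full_rank[OF A True] by blast
    also have "\<dots> \<longleftrightarrow> (\<forall>v \<in> carrier_vec r. A *\<^sub>v v = 0\<^sub>v m \<longrightarrow> v = 0\<^sub>v r)"
      using lin_depI[OF A _ _ _ True] lin_depE[OF A _ True] by metis
    finally show ?thesis using fcr by simp
  next
    case False
    have len: "length (cols A) = r" using A by simp
    obtain S where S: "maximal S (\<lambda>T. T \<subseteq> set (cols A) \<and> lin_indpt T)"
      using maximal_exists_superset[of "set (cols A)"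
          "\<lambda>T. T \<subseteq> set (cols A) \<and> lin_indpt T" "{}"] finite_lin_indpt2[of "{}"]
      by (metis List.finite_set empty_subsetI finite.emptyI empty_iff)
    have "rank A = card S" by (rule rank_card_indpt[OF A S])
    also have "\<dots> \<le> card (set (cols A))"
      using S by (intro card_mono) (auto simp: maximal_def)
    also have "\<dots> < r"
      using False len card_length[of "cols A"] card_distinct[of "cols A"] by linarith
    finally have "\<not> full_column_rank A" using fcr by simp
    obtain i j where ij: "i < r" "j < r" "i \<noteq> j" "col A i = col A j"
      using False len A by (auto simp: distinct_conv_nth)
    define v where "v = unit_vec r i - (unit_vec r j :: real vec)"
    have v: "v \<in> carrier_vec r" by (simp add: v_def)
    have "A *\<^sub>v v = A *\<^sub>v unit_vec r i - A *\<^sub>v unit_vec r j"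
      unfolding v_def by (rule mult_minus_distrib_mat_vec[OF A]) auto
    also have "\<dots> = 0\<^sub>v m"
      using ij mult_unit_vec_col[OF A] A by auto
    finally have "A *\<^sub>v v = 0\<^sub>v m" .
    have "v $ i \<noteq> 0" using ij by (simp add: v_def)
    then have "v \<noteq> 0\<^sub>v r" using ij by auto
    then show ?thesis
      using v \<open>A *\<^sub>v v = 0\<^sub>v m\<close> \<open>\<not> full_column_rank A\<close> by blast
  qed
qed

lemma full_column_rank_mult:
  assumes A: "A \<in> carrier_mat m r" and B: "B \<in> carrier_mat r k"
    and "full_column_rank A" "full_column_rank B"
  shows "full_column_rank (A * B)"
proof -
  have "v = 0\<^sub>v k" if v: "v \<in> carrier_vec k" and "A * B *\<^sub>v v = 0\<^sub>v m" for v
  proof -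
    have "A *\<^sub>v (B *\<^sub>v v) = 0\<^sub>v m" using that A B by (simp add: assoc_mult_mat_vec)
    then have "B *\<^sub>v v = 0\<^sub>v r"
      using assms(3) v B by (simp add: full_column_rank_iff_trivial_kernel[OF A])
    then show ?thesis
      using assms(4) v by (simp add: full_column_rank_iff_trivial_kernel[OF B])
  qed
  then show ?thesis
    using A B by (simp add: full_column_rank_iff_trivial_kernel[of _ m k])
qed

lemma full_column_rank_left_inverse:
  assumes A: "A \<in> carrier_mat m r" and L: "L \<in> carrier_mat r m" and "L * A = 1\<^sub>m r"
  shows "full_column_rank A"
  unfolding full_column_rank_iff_trivial_kernel[OF A]
proof (intro ballI impI)
  fix v :: "real vec" assume v: "v \<in> carrier_vec r" and "A *\<^sub>v v = 0\<^sub>v m"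
  then have "L *\<^sub>v (A *\<^sub>v v) = 0\<^sub>v r" using L by auto
  then show "v = 0\<^sub>v r" using assms v by (simp flip: assoc_mult_mat_vec)
qed

section \<open>Existence and uniqueness of the QR decomposition\<close>

text \<open>Gram--Schmidt with \<open>a j t\<close> the \<open>t\<close>-th coordinate of the \<open>j\<close>-th vector. The last conjunct
  is only there to keep the induction going: it makes the new residual vector nonzero.\<close>

lemma orthonormal_family_exists:
  fixes a :: "nat \<Rightarrow> nat \<Rightarrow> real"
  assumes "\<forall>x. (\<forall>t<n. (\<Sum>j<k. x j * a j t) = 0) \<longrightarrow> (\<forall>j<k. x j = 0)"
  shows "\<exists>q R. (\<forall>i<k. \<forall>j<k. (\<Sum>t<n. q i t * q j t) = (if i = j then 1 else 0)) \<and>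
    (\<forall>j<k. R j j > 0) \<and> (\<forall>j<k. \<forall>t<n. a j t = (\<Sum>i\<le>j. R i j * q i t)) \<and>
    (\<forall>i<k. \<exists>s. \<forall>t<n. q i t = (\<Sum>j<k. s j * a j t))"
  using assms
proof (induction k)
  case 0
  show ?case by simp
next
  case (Suc k)
  have "\<forall>x. (\<forall>t<n. (\<Sum>j<k. x j * a j t) = 0) \<longrightarrow> (\<forall>j<k. x j = 0)"
  proof (intro allI impI)
    fix x j assume "\<forall>t<n. (\<Sum>j<k. x j * a j t) = 0" "j < k"
    then show "x j = 0" using Suc.prems[rule_format, of "x(k := 0)" j] by simp
  qed
  from Suc.IH[OF this] obtain q R where *:
    "\<forall>i<k. \<forall>j<k. (\<Sum>t<n. q i t * q j t) = (if i = j then 1 else 0)"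
    "\<forall>j<k. R j j > 0" "\<forall>j<k. \<forall>t<n. a j t = (\<Sum>i\<le>j. R i j * q i t)"
    "\<forall>i<k. \<exists>s. \<forall>t<n. q i t = (\<Sum>j<k. s j * a j t)"
    by (elim exE conjE)
  note orth = *(1)[rule_format] and pos = *(2)[rule_format] and a = *(3)[rule_format]
  obtain S where S: "\<And>i t. i < k \<Longrightarrow> t < n \<Longrightarrow> q i t = (\<Sum>j<k. S i j * a j t)"
    using *(4)[unfolded choice_iff'] by auto
  \<comment> \<open>\<open>c\<close> holds the coefficients of the orthogonal projection of
    \<open>a k\<close> onto the span of the earlier \<open>q i\<close>, and \<open>v\<close> is the
    residual. Substituting the expansions \<open>S\<close> of the \<open>q i\<close> turns
    \<open>v\<close> into the combination of the \<open>a j\<close> with coefficients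
    \<open>x\<close>.\<close>
  define c where "c i = (\<Sum>t<n. q i t * a k t)" for i
  define v where "v t = a k t - (\<Sum>i<k. c i * q i t)" for t
  define x where "x j = (if j = k then 1 else - (\<Sum>i<k. c i * S i j))" for j
  have v_span: "v t = (\<Sum>j<Suc k. x j * a j t)" if "t < n" for t
  proof -
    have "(\<Sum>i<k. c i * q i t) = (\<Sum>i<k. \<Sum>j<k. c i * S i j * a j t)"
      using S that by (intro sum.cong) (auto simp: sum_distrib_left mult.assoc)
    also have "\<dots> = (\<Sum>j<k. \<Sum>i<k. c i * S i j * a j t)" by (rule sum.swap)
    also have "\<dots> = - (\<Sum>j<k. x j * a j t)"
      by (simp add: x_def sum_distrib_right sum_negf)
    finally show ?thesis by (simp add: v_def x_def)
  qed
  have v_orth: "(\<Sum>t<n. q i t * v t) = 0" if "i < k" for i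
  proof -
    have "(\<Sum>t<n. q i t * v t) = c i - (\<Sum>t<n. \<Sum>j<k. c j * (q i t * q j t))"
      by (simp add: v_def c_def algebra_simps sum_subtractf sum_distrib_left)
    also have "(\<Sum>t<n. \<Sum>j<k. c j * (q i t * q j t)) = (\<Sum>j<k. c j * (\<Sum>t<n. q i t * q j t))"
      by (subst sum.swap) (simp add: sum_distrib_left)
    also have "\<dots> = (\<Sum>j<k. if j = i then c j else 0)"
      using orth that by (intro sum.cong) auto
    also have "\<dots> = c i" using that by (simp add: sum.delta)
    finally show ?thesis by simp
  qed
  define N where "N = sqrt (\<Sum>t<n. v t * v t)"
  \<comment> \<open>A vanishing \<open>v\<close> would be a linear dependence among the
    \<open>a j\<close> whose coefficient at \<open>k\<close> is \<open>x k = 1\<close>.\<close>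
  have "\<exists>t<n. v t \<noteq> 0"
    using Suc.prems[rule_format, of x k] v_span by (fastforce simp: x_def)
  then have "(\<Sum>t<n. v t * v t) > 0"
    by (auto intro!: sum_pos2 simp: zero_less_mult_iff)
  then have N: "N > 0" "(\<Sum>t<n. v t * v t) = N * N" by (auto simp: N_def)
  define q' where "q' = q(k := \<lambda>t. v t / N)"
  \<comment> \<open>The new column solves \<open>v = a k - ...\<close> for \<open>a k\<close>: the
    projection coefficients stand above the diagonal and the length \<open>N\<close> of the residual
    on it.\<close>
  define R' where "R' i j = (if j = k then (if i = k then N else c i) else R i j)" for i j
  have q'k: "q' k t = v t / N" and q'l: "i < k \<Longrightarrow> q' i = q i" for i t
    by (auto simp: q'_def)
  have vk: "(\<Sum>t<n. v t / N * q i t) = 0" "(\<Sum>t<n. q i t * (v t / N)) = 0" if "i < k" for i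
    using v_orth[OF that] by (simp_all add: mult.commute flip: sum_divide_distrib)
  have kk: "(\<Sum>t<n. v t / N * (v t / N)) = 1"
    using N by (simp flip: sum_divide_distrib)
  have "\<forall>i<Suc k. \<forall>j<Suc k. (\<Sum>t<n. q' i t * q' j t) = (if i = j then 1 else 0)"
    using orth vk kk by (auto simp: less_Suc_eq q'k q'l)
  moreover have "\<forall>j<Suc k. R' j j > 0"
    using pos N by (simp add: R'_def)
  moreover have "a j t = (\<Sum>i\<le>j. R' i j * q' i t)" if "j < Suc k" "t < n" for j t
  proof (cases "j = k")
    case True
    have "(\<Sum>i\<le>k. R' i k * q' i t) = (\<Sum>i<k. c i * q i t) + v t"
      using N by (simp add: R'_def q'_def flip: lessThan_Suc_atMost)
    then show ?thesis by (simp add: True v_def)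
  next
    case False
    then have "j < k" using that by simp
    then show ?thesis
      using a[OF _ that(2)] by (auto simp: R'_def q'_def intro!: sum.cong)
  qed
  moreover have "\<exists>s. \<forall>t<n. q' i t = (\<Sum>j<Suc k. s j * a j t)" if "i < Suc k" for i
  proof (cases "i = k")
    case True
    show ?thesis
      by (rule exI[of _ "\<lambda>j. x j / N"]) (simp add: True q'k v_span sum_divide_distrib add_divide_distrib)
  next
    case False
    then show ?thesis
      using S that by (intro exI[of _ "(S i)(k := 0)"]) (auto simp: q'_def)
  qed
  ultimately show ?case by blast
qed

text \<open>Gram--Schmidt applied to the columns, whose independence is the trivial kernel.
  Orthonormality gives only \<open>Q\<^sup>T * Q = 1\<^sub>m n\<close>; the other product follows
  because \<open>Q\<close> is square.\<close>

lemma QR_exists: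
  assumes A: "A \<in> carrier_mat n n" and full: "full_column_rank A"
  shows "\<exists>Q R. QR_decomposition A Q R"
proof -
  define a where "a j t = A $$ (t, j)" for j t
  have "\<forall>x. (\<forall>t<n. (\<Sum>j<n. x j * a j t) = 0) \<longrightarrow> (\<forall>j<n. x j = 0)"
  proof (intro allI impI)
    fix x j assume x: "\<forall>t<n. (\<Sum>j<n. x j * a j t) = 0" and "j < n"
    have "A *\<^sub>v vec n x = 0\<^sub>v n"
      using x A
      by (intro eq_vecI) (auto simp: scalar_prod_def a_def mult.commute atLeast0LessThan)
    then have "vec n x = 0\<^sub>v n"
      using full by (simp add: full_column_rank_iff_trivial_kernel[OF A])
    then show "x j = 0" using \<open>j < n\<close> by (metis index_vec index_zero_vec(1))
  qed
  from orthonormal_family_exists[OF this] obtain q R where *: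
    "\<forall>i<n. \<forall>j<n. (\<Sum>t<n. q i t * q j t) = (if i = j then 1 else 0)"
    "\<forall>j<n. R j j > 0" "\<forall>j<n. \<forall>t<n. a j t = (\<Sum>i\<le>j. R i j * q i t)"
    by (elim exE conjE)
  note orth = *(1)[rule_format] and pos = *(2)[rule_format] and a = *(3)[rule_format]
  define Q where "Q = mat n n (\<lambda>(t, i). q i t)"
  \<comment> \<open>The coefficients \<open>R i j\<close> with \<open>i > j\<close> are unspecified,
    so they are replaced by 0.\<close>
  define U where "U = mat n n (\<lambda>(i, j). if i \<le> j then R i j else 0)"
  have Q: "Q \<in> carrier_mat n n" by (simp add: Q_def)
  have QtQ: "Q\<^sup>T * Q = 1\<^sub>m n"
    using orth by (intro eq_matI) (auto simp: Q_def scalar_prod_def atLeast0LessThan)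
  have "Q * Q\<^sup>T = 1\<^sub>m n"
    by (rule mat_mult_left_right_inverse[OF _ Q QtQ]) (simp add: Q)
  then have "is_orthogonal n Q" using Q QtQ by (simp add: is_orthogonal_def)
  moreover have "Q * U = A"
  proof (rule eq_matI)
    fix t j assume "t < dim_row A" "j < dim_col A"
    then have tj: "t < n" "j < n" using A by auto
    then have "(Q * U) $$ (t, j) = (\<Sum>i<n. q i t * (if i \<le> j then R i j else 0))"
      by (simp add: Q_def U_def scalar_prod_def atLeast0LessThan)
    also have "\<dots> = (\<Sum>i\<le>j. R i j * q i t)"
      using tj by (intro sum.mono_neutral_cong_right) auto
    also have "\<dots> = A $$ (t, j)" using a tj by (simp add: a_def)
    finally show "(Q * U) $$ (t, j) = A $$ (t, j)" .
  qed (use A in \<open>auto simp: Q_def U_def\<close>)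
  moreover have "upper_triangular U" "\<forall>i<dim_row U. U $$ (i, i) > 0" "U \<in> carrier_mat n n"
    using pos by (auto simp: U_def)
  ultimately show ?thesis using A by (auto simp: QR_decomposition_def)
qed

text \<open>This is uniqueness of the Cholesky factor. Entry \<open>(i, j)\<close> of the Gram
  matrix involves only rows up to \<open>i\<close>, so once the rows before \<open>i\<close> agree,
  the products of diagonal entry and entry \<open>(i, j)\<close> agree as well. The case
  \<open>j = i\<close> and positivity give equal diagonal entries; cancelling them gives the rest of
  the row.\<close>

lemma upper_triangular_gram_unique:
  fixes R R' :: "real mat"
  assumes R: "R \<in> carrier_mat n n" "R' \<in> carrier_mat n n"
    and ut: "upper_triangular R" "upper_triangular R'"
    and pos: "\<forall>i<n. R $$ (i, i) > 0" "\<forall>i<n. R' $$ (i, i) > 0"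
    and eq: "R\<^sup>T * R = R'\<^sup>T * R'"
  shows "R = R'"
proof -
  have gram: "(S\<^sup>T * S) $$ (i, j) = (\<Sum>k<i. S $$ (k, i) * S $$ (k, j)) + S $$ (i, i) * S $$ (i, j)"
    if S: "S \<in> carrier_mat n n" "upper_triangular S" and ij: "i < n" "j < n" for S :: "real mat" and i j
  proof -
    have "(S\<^sup>T * S) $$ (i, j) = (\<Sum>k<n. S $$ (k, i) * S $$ (k, j))"
      using S(1) ij by (simp add: scalar_prod_def atLeast0LessThan)
    also have "\<dots> = (\<Sum>k<Suc i. S $$ (k, i) * S $$ (k, j))"
      using S ij by (intro sum.mono_neutral_right) (auto simp: less_Suc_eq)
    finally show ?thesis by simp
  qed
  have rows: "\<forall>j<n. R $$ (i, j) = R' $$ (i, j)" if "i < n" for i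
    using that
  proof (induction i rule: less_induct)
    case (less i)
    have step: "R $$ (i, i) * R $$ (i, j) = R' $$ (i, i) * R' $$ (i, j)" if "j < n" for j
    proof -
      have "(\<Sum>k<i. R $$ (k, i) * R $$ (k, j)) = (\<Sum>k<i. R' $$ (k, i) * R' $$ (k, j))"
        using less that by (intro sum.cong) auto
      then show ?thesis
        using gram[OF R(1) ut(1) less.prems that] gram[OF R(2) ut(2) less.prems that] eq by simp
    qed
    have "R $$ (i, i) = R' $$ (i, i)"
      using step[OF less.prems] pos less.prems
      by (metis less_le power2_eq_iff_nonneg power2_eq_square)
    then show ?case
      using step pos less.prems by (metis less_irrefl mult_left_cancel)
  qed
  show ?thesis using rows R by (intro eq_matI) auto
qed

text \<open>The orthogonal factor cancels in \<open>A\<^sup>T * A = R\<^sup>T * R\<close>, so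
  \<open>R\<close> and \<open>R'\<close> are Cholesky factors of the same matrix. The positive
  diagonal makes \<open>R\<close> invertible, and multiplying \<open>A\<close> by its inverse
  \<open>B\<close> recovers the orthogonal factor.\<close>

lemma QR_unique:
  assumes A: "A \<in> carrier_mat n n" and "QR_decomposition A Q R" "QR_decomposition A Q' R'"
  shows "Q = Q'" "R = R'"
proof -
  have Q: "Q \<in> carrier_mat n n" "Q\<^sup>T * Q = 1\<^sub>m n" "Q * R = A"
    and R: "R \<in> carrier_mat n n" "upper_triangular R" "\<forall>i<n. R $$ (i, i) > 0"
    and Q': "Q' \<in> carrier_mat n n" "Q'\<^sup>T * Q' = 1\<^sub>m n" "Q' * R' = A"
    and R': "R' \<in> carrier_mat n n" "upper_triangular R'" "\<forall>i<n. R' $$ (i, i) > 0"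
    using assms by (auto simp: QR_decomposition_def is_orthogonal_def)
  have gram: "(V * S)\<^sup>T * (V * S) = S\<^sup>T * S"
    if V: "V \<in> carrier_mat n n" "V\<^sup>T * V = 1\<^sub>m n" and S: "S \<in> carrier_mat n n" for V S :: "real mat"
  proof -
    have "(V * S)\<^sup>T * (V * S) = S\<^sup>T * V\<^sup>T * (V * S)"
      using V S by (simp add: transpose_mult)
    also have "\<dots> = S\<^sup>T * (V\<^sup>T * (V * S))"
      using V S by (intro assoc_mult_mat[of _ n n _ n _ n]) auto
    also have "V\<^sup>T * (V * S) = V\<^sup>T * V * S"
      using V S by (intro assoc_mult_mat[symmetric, of _ n n _ n _ n]) auto
    finally show ?thesis using V S by simp
  qed
  show "R = R'"
    using upper_triangular_gram_unique[OF R(1) R'(1) R(2) R'(2) R(3) R'(3)]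
      gram[OF Q(1,2) R(1)] gram[OF Q'(1,2) R'(1)] Q(3) Q'(3) by simp
  have "det R \<noteq> 0"
    using R by (subst upper_triangular_imp_det_eq_0_iff[OF R(1,2)]) (auto simp: diag_mat_def)
  then obtain B where B: "B \<in> carrier_mat n n" "R * B = 1\<^sub>m n"
    using det_non_zero_imp_unit[OF R(1)] by (auto simp: Units_def ring_mat_def)
  have inv: "V * R * B = V" if "V \<in> carrier_mat n n" for V
    using that R(1) B by (simp add: assoc_mult_mat[of _ n n _ n _ n])
  show "Q = Q'"
    using inv[OF Q(1)] inv[OF Q'(1)] Q(3) Q'(3) \<open>R = R'\<close> by simp
qed

section \<open>Pivot rows as an invariant of the column space\<close>

lemma index_mult_mat_sum:
  assumes "A \<in> carrier_mat m r" "B \<in> carrier_mat r s" "i < m" "j < s"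
  shows "(A * B) $$ (i, j) = (\<Sum>k<r. A $$ (i, k) * B $$ (k, j))"
  using assms by (simp add: scalar_prod_def atLeast0LessThan)

text \<open>Take \<open>k\<close> to be the first nonzero coordinate of \<open>v\<close>. The
  columns before \<open>k\<close> get coefficient 0 and those after \<open>k\<close> start strictly
  below row \<open>l k\<close>, so the product vanishes above that row and equals
  \<open>A $$ (l k, k) * v $ k\<close> in it.\<close>

lemma mult_vec_first_nonzero:
  assumes A: "A \<in> carrier_mat m r" and mono: "strict_mono_on {..<r} l"
    and piv: "\<forall>j<r. is_pivot_row A j (l j)"
    and v: "v \<in> carrier_vec r" "v \<noteq> 0\<^sub>v r"
  shows "\<exists>k<r. (A *\<^sub>v v) $ l k \<noteq> 0 \<and> (\<forall>i<l k. (A *\<^sub>v v) $ i = 0)"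
proof -
  define k where "k = (LEAST k. k < r \<and> v $ k \<noteq> 0)"
  have "\<exists>k. k < r \<and> v $ k \<noteq> 0" using v by (auto simp: vec_eq_iff)
  then have "k < r \<and> v $ k \<noteq> 0" unfolding k_def by (rule LeastI_ex)
  then have k: "k < r" "v $ k \<noteq> 0" by auto
  have below: "v $ j = 0" if "j < k" for j
    using not_less_Least[of j "\<lambda>k. k < r \<and> v $ k \<noteq> 0"] that k by (auto simp: k_def)
  have mult: "(A *\<^sub>v v) $ i = (\<Sum>j<r. A $$ (i, j) * v $ j)" if "i < m" for i
    using that A v by (simp add: scalar_prod_def atLeast0LessThan)
  have lk: "l j < m" if "j < r" for j
    using piv that A by (auto simp: is_pivot_row_def)
  have zero: "A $$ (i, j) = 0" if "k \<le> j" "j < r" "i < l k \<or> i = l k \<and> j \<noteq> k" for i j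
  proof -
    have "l k < l j" if "k \<noteq> j"
      using strict_mono_onD[OF mono, of k j] \<open>k \<le> j\<close> \<open>j < r\<close> that by auto
    then have "i < l j" using that by (cases "k = j") auto
    then show ?thesis using piv \<open>j < r\<close> by (auto simp: is_pivot_row_def)
  qed
  have "(A *\<^sub>v v) $ i = 0" if "i < l k" for i
    using mult[of i] below zero lk[OF k(1)] that
    by (auto intro!: sum.neutral) (metis leI)
  moreover have "(A *\<^sub>v v) $ l k = (\<Sum>j<r. if j = k then A $$ (l k, k) * v $ k else 0)"
    unfolding mult[OF lk[OF k(1)]] using below zero
    by (intro sum.cong) (auto, metis leI)
  then have "(A *\<^sub>v v) $ l k \<noteq> 0"
    using k piv by (auto simp: is_pivot_row_def)
  ultimately show ?thesis using k by blast
qed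

lemma sorted_list_of_strict_mono_image:
  fixes f :: "nat \<Rightarrow> nat"
  assumes "strict_mono_on {..<n} f"
  shows "sorted_list_of_set (f ` {..<n}) = map f [0..<n]"
proof (rule sorted_distinct_set_unique)
  show "sorted (map f [0..<n])"
    using strict_mono_on_leD[OF assms] by (auto simp: sorted_iff_nth_mono)
  show "distinct (map f [0..<n])"
    using strict_mono_on_imp_inj_on[OF assms] by (simp add: distinct_map atLeast0LessThan)
qed (auto simp: atLeast0LessThan)

text \<open>Both images have \<open>n\<close> elements, so the inclusion is an equality, and a
  finite set has only one increasing enumeration.\<close>

lemma strict_mono_on_image_eq:
  fixes f g :: "nat \<Rightarrow> nat"
  assumes f: "strict_mono_on {..<n} f" and g: "strict_mono_on {..<n} g"
    and sub: "g ` {..<n} \<subseteq> f ` {..<n}" and "j < n"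
  shows "g j = f j"
proof -
  have "inj_on f {..<n}" "inj_on g {..<n}"
    using f g by (auto intro: strict_mono_on_imp_inj_on)
  then have "g ` {..<n} = f ` {..<n}"
    using sub by (intro card_subset_eq) (auto simp: card_image)
  then have "map g [0..<n] = map f [0..<n]"
    using sorted_list_of_strict_mono_image[OF f] sorted_list_of_strict_mono_image[OF g] by simp
  then show ?thesis using \<open>j < n\<close> by auto
qed

text \<open>Each column of \<open>A * M\<close> is \<open>A\<close> applied to a column of
  \<open>M\<close>, which is nonzero because the product has a pivot there. So its first nonzero
  entry lies in a pivot row of \<open>A\<close>, and the increasing order then forces the two
  enumerations to agree.\<close>

lemma pivot_rows_mult_unique:
  assumes A: "A \<in> carrier_mat m r" and M: "M \<in> carrier_mat r r"
    and l: "strict_mono_on {..<r} l" "\<forall>j<r. is_pivot_row A j (l j)"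
    and l': "strict_mono_on {..<r} l'" "\<forall>j<r. is_pivot_row (A * M) j (l' j)"
    and "j < r"
  shows "l' j = l j"
proof (rule strict_mono_on_image_eq[OF l(1) l'(1) _ \<open>j < r\<close>], safe)
  fix j assume "j < r"
  have col: "A *\<^sub>v col M j = col (A * M) j" by (rule col_mult2[OF A M \<open>j < r\<close>, symmetric])
  have piv: "l' j < m" "(A * M) $$ (l' j, j) \<noteq> 0" "\<forall>i<l' j. (A * M) $$ (i, j) = 0"
    using l'(2) \<open>j < r\<close> A by (auto simp: is_pivot_row_def)
  have ent: "(A *\<^sub>v col M j) $ i = (A * M) $$ (i, j)" if "i < m" for i
    unfolding col using that A M \<open>j < r\<close> by simp
  have "col M j \<noteq> 0\<^sub>v r"
    using ent[OF piv(1)] piv A by auto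
  then obtain k where k: "k < r" "(A *\<^sub>v col M j) $ l k \<noteq> 0" "\<forall>i<l k. (A *\<^sub>v col M j) $ i = 0"
    using mult_vec_first_nonzero[OF A l, of "col M j"] M \<open>j < r\<close> by auto
  have "l k < m" using l(2) k A by (auto simp: is_pivot_row_def)
  then have "l' j = l k"
    using k piv ent by (metis less_trans linorder_neqE_nat)
  then show "l' j \<in> l ` {..<r}" using k by auto
qed

section \<open>Column echelon factorization from the reduced row echelon form\<close>

text \<open>With \<open>C = P * \<beta>\<^sup>T\<close> and \<open>P'\<close> inverse to
  \<open>P\<close>, the factors are \<open>E = C\<^sup>T\<close> and \<open>M = P'\<^sup>T\<close>,
  and \<open>f\<close> is the pivot function of \<open>C\<close>. Reading
  \<open>\<beta> = E * M\<close> in the rows \<open>f i\<close>, where \<open>E\<close> is the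
  identity, shows that \<open>M\<close> is the selected submatrix.\<close>

lemma rref_transpose_factorization:
  assumes \<beta>: "\<beta> \<in> carrier_mat m r" and full: "full_column_rank \<beta>"
    and C: "is_rref_of C \<beta>\<^sup>T"
  obtains f E M where "E \<in> carrier_mat m r" "M \<in> carrier_mat r r"
    "full_column_rank M\<^sup>T" "\<beta> = E * M" "strict_mono_on {..<r} f"
    "\<forall>j<r. is_pivot_row E j (f j)"
    "\<forall>i<r. \<forall>j<r. E $$ (f i, j) = (if i = j then 1 else 0)"
    "sorted_list_of_set (pivot_columns C) = map f [0..<r]"
    "mat_of_rows r (map (row \<beta>) (map f [0..<r])) = M"
proof -
  obtain P where P: "P \<in> carrier_mat r r" "invertible_mat P" "C = P * \<beta>\<^sup>T"
    using C \<beta> by (auto simp: is_rref_of_def)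
  then obtain P' where P': "P * P' = 1\<^sub>m r" "P' * P = 1\<^sub>m (dim_row P')"
    by (auto simp: invertible_mat_def inverts_mat_def)
  \<comment> \<open>Invertibility does not state the dimensions of \<open>P'\<close>; they are read
    off from the two products.\<close>
  then have P'c: "P' \<in> carrier_mat r r"
    by (metis P(1) carrier_matD(2) carrier_matI index_mult_mat(3) index_one_mat(3))
  then have P'P: "P' * P = 1\<^sub>m r" using P' by auto
  have Cc: "C \<in> carrier_mat r m" using P \<beta> by auto
  obtain f where f: "pivot_fun C f m"
    using C Cc by (auto simp: is_rref_of_def row_echelon_form_def)
  have dimC: "dim_row C = r" using Cc by simp
  note piv = pivot_funD[OF dimC f]
  have \<beta>T: "\<beta>\<^sup>T = P' * C"
    using P P'c P'P \<beta> by (simp flip: assoc_mult_mat[of _ r r _ r _ m])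
  have CT: "C\<^sup>T = \<beta> * P\<^sup>T"
    using P \<beta> by (simp add: transpose_mult[of _ r r _ m])
  have fullP: "full_column_rank P\<^sup>T"
    by (rule full_column_rank_left_inverse[of _ r r "P'\<^sup>T"])
      (use P P' P'c in \<open>auto simp flip: transpose_mult\<close>)
  have "full_column_rank C\<^sup>T"
    unfolding CT by (rule full_column_rank_mult[OF \<beta> _ full fullP]) (use P in simp)
  \<comment> \<open>A pivot function takes the value \<open>m\<close> exactly on zero rows. Row
    \<open>i\<close> of \<open>C\<close> is the image of a unit vector under
    \<open>C\<^sup>T\<close>, hence nonzero.\<close>
  then have fm: "f i < m" if "i < r" for i
  proof -
    have "C\<^sup>T *\<^sub>v unit_vec r i \<noteq> 0\<^sub>v m"
      using \<open>full_column_rank C\<^sup>T\<close> Cc that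
      by (auto simp: full_column_rank_iff_trivial_kernel[of _ m r])
    then have "row C i \<noteq> 0\<^sub>v m"
      using mult_unit_vec_col[of "C\<^sup>T" m r i] Cc that by simp
    then show ?thesis
      using pivot_fun_zero_row_iff[OF f Cc that] piv(1)[OF that] by linarith
  qed
  \<comment> \<open>Consecutive pivots increase unless the later one is \<open>m\<close>, which
    \<open>fm\<close> excludes.\<close>
  have mono: "strict_mono_on {..<r} f"
  proof (rule strict_mono_onI)
    fix i j assume ij: "i \<in> {..<r}" "j \<in> {..<r}" "i < j"
    show "f i < f j"
    proof (rule lift_Suc_mono_less_ivl[OF _ ij(3) order_refl])
      fix k assume "k \<in> {i..<j}"
      then show "f k < f (Suc k)"
        using piv(3)[of k] fm[of "Suc k"] ij by auto
    qed
  qed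
  have pc: "pivot_columns C = f ` {..<r}"
  proof (intro equalityI subsetI)
    fix j assume "j \<in> pivot_columns C"
    then obtain i where i: "i < r" "C $$ (i, j) = 1" "\<forall>j'<j. C $$ (i, j') = 0"
      using dimC by (auto simp: pivot_columns_def)
    then have "j = f i"
      using piv(2)[OF i(1), of j] piv(4)[OF i(1) fm[OF i(1)]]
      by (metis linorder_neqE_nat zero_neq_one)
    then show "j \<in> f ` {..<r}" using i by auto
  next
    fix j assume "j \<in> f ` {..<r}"
    then show "j \<in> pivot_columns C"
      using piv(2,4) fm Cc by (auto simp: pivot_columns_def)
  qed
  have l: "sorted_list_of_set (pivot_columns C) = map f [0..<r]"
    unfolding pc by (rule sorted_list_of_strict_mono_image[OF mono])
  have E: "C\<^sup>T $$ (f i, j) = (if i = j then 1 else 0)" if "i < r" "j < r" for i j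
    using piv(4,5) fm Cc that by auto
  have Z: "C\<^sup>T $$ (i, j) = 0" if "j < r" "i < f j" for i j
    using piv(2)[OF that] fm[OF that(1)] Cc that by simp
  have M: "P'\<^sup>T \<in> carrier_mat r r" using P'c by simp
  have \<beta>_eq: "\<beta> = C\<^sup>T * P'\<^sup>T"
    using \<beta>T P'c Cc transpose_mult[OF P'c Cc] by (metis transpose_transpose)
  show thesis
  proof (rule that[of "C\<^sup>T" "P'\<^sup>T" f])
    show "full_column_rank P'\<^sup>T\<^sup>T"
      using full_column_rank_left_inverse[OF P'c P(1) P'(1)] by simp
    show "\<forall>j<r. is_pivot_row C\<^sup>T j (f j)"
      using E Z fm Cc by (simp add: is_pivot_row_def del: index_transpose_mat(1))
    show "mat_of_rows r (map (row \<beta>) (map f [0..<r])) = P'\<^sup>T"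
    proof (rule eq_matI)
      fix i k assume "i < dim_row P'\<^sup>T" "k < dim_col P'\<^sup>T"
      then have ik: "i < r" "k < r" using M by auto
      have "mat_of_rows r (map (row \<beta>) (map f [0..<r])) $$ (i, k) = \<beta> $$ (f i, k)"
        using ik fm \<beta> by (simp add: mat_of_rows_index)
      also have "\<dots> = (\<Sum>j<r. C\<^sup>T $$ (f i, j) * P'\<^sup>T $$ (j, k))"
        unfolding \<beta>_eq using ik fm Cc M by (intro index_mult_mat_sum) auto
      also have "\<dots> = (\<Sum>j<r. if i = j then P'\<^sup>T $$ (j, k) else 0)"
        using E ik by (intro sum.cong) auto
      also have "\<dots> = P'\<^sup>T $$ (i, k)" using ik by simp
      finally show "mat_of_rows r (map (row \<beta>) (map f [0..<r])) $$ (i, k) = P'\<^sup>T $$ (i, k)" .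
    qed (use M in auto)
  qed (use Cc M \<beta>_eq mono E l in auto)
qed

section \<open>Correspondence between GLT and QR decompositions\<close>

text \<open>Column \<open>j\<close> of \<open>E * R\<^sup>T\<close> combines only columns
  \<open>k \<ge> j\<close> of \<open>E\<close>, all zero above row \<open>f j\<close>; in that row
  the identity block leaves \<open>R $$ (j, j) > 0\<close>. The rank is kept because
  \<open>E * R\<^sup>T = E * M * Q\<close> with \<open>Q\<close> orthogonal.\<close>

lemma GLT_decomposition_of_QR:
  assumes E: "E \<in> carrier_mat m r" and M: "M \<in> carrier_mat r r"
    and full: "full_column_rank (E * M)"
    and mono: "strict_mono_on {..<r} f" and piv: "\<forall>j<r. is_pivot_row E j (f j)"
    and unit: "\<forall>i<r. \<forall>j<r. E $$ (f i, j) = (if i = j then 1 else 0)"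
    and QR: "QR_decomposition M\<^sup>T Q R"
  shows "GLT_decomposition (E * M) (E * R\<^sup>T) Q"
proof -
  have Q: "Q \<in> carrier_mat r r" "is_orthogonal r Q"
    and R: "R \<in> carrier_mat r r" "upper_triangular R" "\<forall>i<r. R $$ (i, i) > 0"
    and QRM: "Q * R = M\<^sup>T"
    using QR M by (auto simp: QR_decomposition_def is_orthogonal_def)
  have "M = R\<^sup>T * Q\<^sup>T"
    using QRM transpose_mult[OF Q(1) R(1)] by (metis transpose_transpose)
  then have EM: "E * M = E * R\<^sup>T * Q\<^sup>T"
    using E R Q by (simp add: assoc_mult_mat[of _ m r _ r _ r])
  have "E * R\<^sup>T = E * M * Q"
    unfolding EM using E R Q
    by (simp add: assoc_mult_mat[of _ m r _ r _ r] is_orthogonal_def)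
  moreover have "full_column_rank Q"
    using Q by (intro full_column_rank_left_inverse[of Q r r "Q\<^sup>T"]) (auto simp: is_orthogonal_def)
  ultimately have "full_column_rank (E * R\<^sup>T)"
    using full_column_rank_mult[of "E * M" m r Q r] E M Q full by simp
  have fm: "f j < m" if "j < r" for j
    using piv E that by (auto simp: is_pivot_row_def)
  have ent: "(E * R\<^sup>T) $$ (i, j) = (\<Sum>k<r. E $$ (i, k) * R $$ (j, k))" if "i < m" "j < r" for i j
    using that E R index_mult_mat_sum[of E m r "R\<^sup>T" r i j] by simp
  have diag: "(E * R\<^sup>T) $$ (f j, j) = R $$ (j, j)" if "j < r" for j
  proof -
    have "(E * R\<^sup>T) $$ (f j, j) = (\<Sum>k<r. if j = k then R $$ (j, k) else 0)"
      unfolding ent[OF fm[OF that] that] using unit that by (intro sum.cong) auto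
    then show ?thesis using that by simp
  qed
  have zero: "(E * R\<^sup>T) $$ (i, j) = 0" if "j < r" "i < f j" for i j
  proof -
    have "E $$ (i, k) * R $$ (j, k) = 0" if "k < r" for k
    proof (cases "k < j")
      case True
      then show ?thesis using upper_triangularD[OF R(2), of k j] R(1) \<open>j < r\<close> by simp
    next
      case False
      then have "i < f k"
        using strict_mono_on_leD[OF mono, of j k] \<open>i < f j\<close> \<open>j < r\<close> that by auto
      then show ?thesis using piv that by (simp add: is_pivot_row_def)
    qed
    then show ?thesis using ent[of i j] that fm[OF that(1)] by (simp add: sum.neutral)
  qed
  have "ordered_GLT (E * R\<^sup>T)"
    unfolding ordered_GLT_def
  proof (intro conjI exI[of _ f])
    show "\<forall>j<dim_col (E * R\<^sup>T). is_pivot_row (E * R\<^sup>T) j (f j) \<and> (E * R\<^sup>T) $$ (f j, j) > 0"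
      using diag zero fm R E by (fastforce simp: is_pivot_row_def simp del: index_mult_mat(1))
    show "strict_mono_on {..<dim_col (E * R\<^sup>T)} f" using mono R by simp
  qed fact
  then show ?thesis
    using E M R Q EM by (auto simp: GLT_decomposition_def)
qed

text \<open>Since \<open>\<Lambda> = E * (M * G)\<close>, its pivot rows are those of
  \<open>E\<close>, and the identity block of \<open>E\<close> makes its rows \<open>f i\<close>
  equal to the rows of \<open>M * G\<close>. The staircase shape and positive leading entries of
  \<open>\<Lambda>\<close> thus become triangularity and a positive diagonal of
  \<open>(M * G)\<^sup>T\<close>.\<close>

lemma QR_of_GLT_decomposition:
  assumes E: "E \<in> carrier_mat m r" and M: "M \<in> carrier_mat r r"
    and mono: "strict_mono_on {..<r} f" and piv: "\<forall>j<r. is_pivot_row E j (f j)"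
    and unit: "\<forall>i<r. \<forall>j<r. E $$ (f i, j) = (if i = j then 1 else 0)"
    and GLT: "GLT_decomposition (E * M) \<Lambda> G"
  shows "\<Lambda> = E * M * G" "\<forall>j<r. is_pivot_row \<Lambda> j (f j)"
    "QR_decomposition M\<^sup>T G (M * G)\<^sup>T"
proof -
  have \<Lambda>: "\<Lambda> \<in> carrier_mat m r" "ordered_GLT \<Lambda>"
    and G: "G \<in> carrier_mat r r" "G\<^sup>T * G = 1\<^sub>m r" "G * G\<^sup>T = 1\<^sub>m r" "is_orthogonal r G"
    and eq: "E * M = \<Lambda> * G\<^sup>T"
    using GLT E M by (auto simp: GLT_decomposition_def is_orthogonal_def)
  show \<Lambda>_eq: "\<Lambda> = E * M * G"
    unfolding eq using \<Lambda> G by (simp add: assoc_mult_mat[of _ m r _ r _ r])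
  also have "\<dots> = E * (M * G)"
    using E M G by (simp add: assoc_mult_mat[of _ m r _ r _ r])
  finally have \<Lambda>_EMG: "\<Lambda> = E * (M * G)" .
  have MG: "M * G \<in> carrier_mat r r" using M G by simp
  obtain l where l: "\<forall>j<r. is_pivot_row \<Lambda> j (l j)" "\<forall>j<r. \<Lambda> $$ (l j, j) > 0"
    "strict_mono_on {..<r} l"
    using \<Lambda> by (auto simp: ordered_GLT_def)
  have "l j = f j" if "j < r" for j
    using pivot_rows_mult_unique[OF E MG mono piv l(3) _ that] l(1) \<Lambda>_EMG by simp
  then have l_f: "\<forall>j<r. is_pivot_row \<Lambda> j (f j)" "\<forall>j<r. \<Lambda> $$ (f j, j) > 0"
    using l by auto
  then show "\<forall>j<r. is_pivot_row \<Lambda> j (f j)" by simp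
  have MG_ent: "(M * G) $$ (i, j) = \<Lambda> $$ (f i, j)" if "i < r" "j < r" for i j
  proof -
    have "f i < m" using piv E that by (auto simp: is_pivot_row_def)
    then have "\<Lambda> $$ (f i, j) = (\<Sum>k<r. E $$ (f i, k) * (M * G) $$ (k, j))"
      unfolding \<Lambda>_EMG using that by (intro index_mult_mat_sum[OF E MG])
    also have "\<dots> = (\<Sum>k<r. if i = k then (M * G) $$ (k, j) else 0)"
      using unit that by (intro sum.cong) auto
    finally show ?thesis using that by simp
  qed
  have "upper_triangular (M * G)\<^sup>T"
  proof (rule upper_triangularI)
    fix i j assume "j < i" "i < dim_row (M * G)\<^sup>T"
    then have ij: "j < i" "i < r" using MG by auto
    then have "f j < f i" using strict_mono_onD[OF mono] by simp
    then show "(M * G)\<^sup>T $$ (i, j) = 0"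
      using ij M G MG_ent[of j i] l_f(1)
      by (simp add: is_pivot_row_def del: index_mult_mat(1))
  qed
  moreover have "\<forall>i<r. (M * G)\<^sup>T $$ (i, i) > 0"
    using M G MG_ent l_f(2) by (simp del: index_mult_mat(1))
  moreover have "G * (M * G)\<^sup>T = M\<^sup>T"
    using G M by (simp add: transpose_mult[of _ r r _ r] flip: assoc_mult_mat[of _ r r _ r _ r])
  ultimately show "QR_decomposition M\<^sup>T G (M * G)\<^sup>T"
    using G M MG by (simp add: QR_decomposition_def)
qed

section \<open>Existence, uniqueness and identification of the two decompositions\<close>

lemma ex1_pairI:
  assumes "P a b" "\<And>x y. P x y \<Longrightarrow> x = a \<and> y = b"
  shows "\<exists>!p. case p of (x, y) \<Rightarrow> P x y"
proof (rule ex1I[of _ "(a, b)"])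
  fix p assume "case p of (x, y) \<Rightarrow> P x y"
  then show "p = (a, b)" using assms(2) by (cases p) simp
qed (simp add: assms(1))

theorem theorem2:
  fixes \<beta> :: "real mat" and m r :: nat
  assumes "\<beta> \<in> carrier_mat m r"
    and "full_column_rank \<beta>"
  shows "(\<exists>!(p :: real mat \<times> real mat). case p of (\<Lambda>, G) \<Rightarrow> GLT_decomposition \<beta> \<Lambda> G) \<and>
    (\<forall>C. is_rref_of C \<beta>\<^sup>T \<longrightarrow>
      (let l = sorted_list_of_set (pivot_columns C);
           \<beta>1 = mat_of_rows r (map (row \<beta>) l)
       in length l = r \<and>
          (\<exists>!(p :: real mat \<times> real mat). case p of (Q, R) \<Rightarrow> QR_decomposition \<beta>1\<^sup>T Q R) \<and>
          (\<forall>\<Lambda> G Q R. GLT_decomposition \<beta> \<Lambda> G \<and> QR_decomposition \<beta>1\<^sup>T Q R \<longrightarrow>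
             \<Lambda> = \<beta> * G \<and> (\<forall>j < r. is_pivot_row \<Lambda> j (l ! j)) \<and> G = Q)))"
proof (intro conjI allI impI)
  \<comment> \<open>Part (a) does not mention an echelon form; any one serves to factor
    \<open>\<beta>\<close>.\<close>
  obtain C where C: "is_rref_of C \<beta>\<^sup>T" using rref_exists by blast
  obtain f E M where
    E: "E \<in> carrier_mat m r" and M: "M \<in> carrier_mat r r" "full_column_rank M\<^sup>T"
    and \<beta>: "\<beta> = E * M"
    and f: "strict_mono_on {..<r} f" "\<forall>j<r. is_pivot_row E j (f j)"
      "\<forall>i<r. \<forall>j<r. E $$ (f i, j) = (if i = j then 1 else 0)"
    and "sorted_list_of_set (pivot_columns C) = map f [0..<r]"
    and "mat_of_rows r (map (row \<beta>) (map f [0..<r])) = M"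
    by (rule rref_transpose_factorization[OF assms C])
  have MT: "M\<^sup>T \<in> carrier_mat r r" using M by simp
  obtain Q R where QR: "QR_decomposition M\<^sup>T Q R" using QR_exists[OF MT M(2)] by blast
  have GLT: "GLT_decomposition \<beta> (E * R\<^sup>T) Q"
    using GLT_decomposition_of_QR[OF E M(1) _ f QR] assms(2) \<beta> by simp
  have "\<Lambda> = E * R\<^sup>T \<and> G = Q" if "GLT_decomposition \<beta> \<Lambda> G" for \<Lambda> G
  proof -
    \<comment> \<open>Uniqueness of QR fixes the rotation, and the rotation fixes the GLT factor.
      Applying this to the given pair and to the constructed one makes them equal.\<close>
    have "\<Lambda>' = \<beta> * G' \<and> G' = Q" if "GLT_decomposition \<beta> \<Lambda>' G'" for \<Lambda>' G'
      using QR_of_GLT_decomposition[OF E M(1) f that[unfolded \<beta>]] QR_unique(1)[OF MT _ QR] \<beta>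
      by auto
    from this[OF that] this[OF GLT] show ?thesis by simp
  qed
  with GLT show "\<exists>!p. case p of (\<Lambda>, G) \<Rightarrow> GLT_decomposition \<beta> \<Lambda> G"
    by (rule ex1_pairI)
next
  fix C assume C: "is_rref_of C \<beta>\<^sup>T"
  obtain f E M where
    E: "E \<in> carrier_mat m r" and M: "M \<in> carrier_mat r r" "full_column_rank M\<^sup>T"
    and \<beta>: "\<beta> = E * M"
    and f: "strict_mono_on {..<r} f" "\<forall>j<r. is_pivot_row E j (f j)"
      "\<forall>i<r. \<forall>j<r. E $$ (f i, j) = (if i = j then 1 else 0)"
    and l: "sorted_list_of_set (pivot_columns C) = map f [0..<r]"
    and \<beta>1: "mat_of_rows r (map (row \<beta>) (map f [0..<r])) = M"
    by (rule rref_transpose_factorization[OF assms C])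
  have MT: "M\<^sup>T \<in> carrier_mat r r" using M by simp
  obtain Q R where QR: "QR_decomposition M\<^sup>T Q R" using QR_exists[OF MT M(2)] by blast
  have "\<exists>!p. case p of (Q, R) \<Rightarrow> QR_decomposition M\<^sup>T Q R"
    by (rule ex1_pairI, rule QR) (use QR_unique[OF MT _ QR] in blast)
  \<comment> \<open>\<open>G\<close> is itself the orthogonal factor of a QR decomposition of
    \<open>M\<^sup>T\<close>, so it coincides with every such \<open>Q\<close>.\<close>
  moreover have "\<Lambda> = \<beta> * G \<and> (\<forall>j<r. is_pivot_row \<Lambda> j (map f [0..<r] ! j)) \<and> G = Q"
    if "GLT_decomposition \<beta> \<Lambda> G" "QR_decomposition M\<^sup>T Q R" for \<Lambda> G Q R
    using QR_of_GLT_decomposition[OF E M(1) f that(1)[unfolded \<beta>]] QR_unique(1)[OF MT _ that(2)] \<beta>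
    by auto
  ultimately show "let l = sorted_list_of_set (pivot_columns C);
           \<beta>1 = mat_of_rows r (map (row \<beta>) l)
       in length l = r \<and>
          (\<exists>!(p :: real mat \<times> real mat). case p of (Q, R) \<Rightarrow> QR_decomposition \<beta>1\<^sup>T Q R) \<and>
          (\<forall>\<Lambda> G Q R. GLT_decomposition \<beta> \<Lambda> G \<and> QR_decomposition \<beta>1\<^sup>T Q R \<longrightarrow>
             \<Lambda> = \<beta> * G \<and> (\<forall>j < r. is_pivot_row \<Lambda> j (l ! j)) \<and> G = Q)"
    unfolding Let_def l \<beta>1 by auto
qed

end
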